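(* Let $d$ be a positive integer and let $f\colon\mathbb{N}^d\to\mathbb{N}$ be any $d$-tupling function with cubic shells. Let $n$ be a non-negative integer. If the non-negative integers $x_1,x_2,\ldots,x_d$ each have a binary representation with $n$ or fewer bits, then the binary representation of $f(x_1,x_2,\ldots,x_d)$ has $nd$ or fewer bits.
   Context: $\mathbb{N}$ denotes the set of non-negative integers. A $d$-tupling function for $\mathbb{N}$ is a bijection $\mathbb{N}^d\to\mathbb{N}$; it has cubic shells if for all $\mathbf{x},\mathbf{y}\in\mathbb{N}^d$, $\max(\mathbf{x})<\max(\mathbf{y})$ implies $f(\mathbf{x})<f(\mathbf{y})$. The number of bits in the binary representation of a non-negative integer $x$ is $\lceil\log_2(x+1)\rceil$. *)

theory Defs
  imports Complex_Main
begin

definition tuples :: "nat \<Rightarrow> nat list set" where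
  "tuples d = {xs. length xs = d}"

definition tupling_function :: "nat \<Rightarrow> (nat list \<Rightarrow> nat) \<Rightarrow> bool" where
  "tupling_function d f \<longleftrightarrow> bij_betw f (tuples d) UNIV"

text \<open>The maximum is unspecified for the empty tuple, so this notion is only meaningful
  for positive dimension.\<close>

definition cubic_shells :: "nat \<Rightarrow> (nat list \<Rightarrow> nat) \<Rightarrow> bool" where
  "cubic_shells d f \<longleftrightarrow>
     (\<forall>xs \<in> tuples d. \<forall>ys \<in> tuples d. Max (set xs) < Max (set ys) \<longrightarrow> f xs < f ys)"

text \<open>Zero has the empty binary representation, of 0 bits. The ceiling is
  non-negative, so the conversion to a natural number loses nothing.\<close>

definition num_bits :: "nat \<Rightarrow> nat" where
  "num_bits x = nat \<lceil>log 2 (real x + 1)\<rceil>"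

end

theory Submission
  imports Defs
begin

text \<open>Cubic shells force every value up to \<open>f xs\<close> to be attained on the cube \<open>{..<m}\<^sup>d\<close>
  as soon as this cube contains \<open>xs\<close>, so counting the cube gives \<open>f xs < m\<^sup>d\<close>. Having at most \<open>n\<close> bits
  means being below \<open>2\<^sup>n\<close>, so the case \<open>m = 2\<^sup>n\<close> yields the bound.\<close>

text \<open>The ceiling drops out because the bound \<open>n\<close> is an integer. The shift in
  \<open>real x + 1\<close> then turns \<open>\<le>\<close> into \<open><\<close> for
  naturals.\<close>

lemma num_bits_le_iff: "num_bits x \<le> n \<longleftrightarrow> x < 2 ^ n"
proof -
  have "num_bits x \<le> n \<longleftrightarrow> log 2 (real x + 1) \<le> real n"
    by (simp add: num_bits_def nat_le_iff ceiling_le_iff)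
  also have "\<dots> \<longleftrightarrow> real x + 1 \<le> 2 ^ n"
    by (simp add: log_le_iff powr_realpow)
  also have "\<dots> \<longleftrightarrow> real (Suc x) \<le> real (2 ^ n)"
    by (simp add: add.commute)
  also have "\<dots> \<longleftrightarrow> x < 2 ^ n"
    by (simp only: of_nat_le_iff Suc_le_eq)
  finally show ?thesis .
qed

lemma cubic_shells_less_power:
  assumes "d > 0" "tupling_function d f" "cubic_shells d f"
    and xs: "xs \<in> tuples d" "set xs \<subseteq> {..<m}"
  shows "f xs < m ^ d"
proof -
  define B where "B = {ys. set ys \<subseteq> {..<m} \<and> length ys = d}"
  have "finite B" and card_B: "card B = m ^ d"
    unfolding B_def by (simp_all add: finite_lists_length_eq card_lists_length_eq)
  have "{..f xs} \<subseteq> f ` B"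
  proof
    fix k assume "k \<in> {..f xs}"
    moreover obtain ys where ys: "ys \<in> tuples d" "k = f ys"
      using assms(2) unfolding tupling_function_def bij_betw_def by blast
    moreover have "set ys \<subseteq> {..<m}"
    proof (rule ccontr)
      \<comment> \<open>An entry \<open>y\<close> outside the cube would put \<open>ys\<close> on a
        later shell than \<open>xs\<close>, contradicting
        \<open>f ys = k \<le> f xs\<close>.\<close>
      assume "\<not> set ys \<subseteq> {..<m}"
      then obtain y where y: "y \<in> set ys" "m \<le> y"
        by (meson lessThan_iff not_less subsetI)
      \<comment> \<open>Positive dimension is what gives \<open>Max (set xs)\<close> a
        meaning.\<close>
      have "set xs \<noteq> {}"
        using \<open>d > 0\<close> xs(1) by (auto simp: tuples_def)
      then have "Max (set xs) < m"
        using xs(2) by auto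
      also have "m \<le> Max (set ys)"
        using y by (meson List.finite_set Max_ge le_trans)
      finally have "f xs < f ys"
        using assms(3) xs(1) ys(1) unfolding cubic_shells_def by blast
      with ys(2) \<open>k \<in> {..f xs}\<close> show False by simp
    qed
    ultimately show "k \<in> f ` B"
      by (auto simp: B_def tuples_def)
  qed
  then have "card {..f xs} \<le> card B"
    using \<open>finite B\<close> surj_card_le by blast
  \<comment> \<open>The initial segment \<open>{..f xs}\<close> includes 0, so it has
    \<open>f xs + 1\<close> elements; this makes the bound strict.\<close>
  then show ?thesis
    by (simp add: card_B)
qed

theorem theorem11:
  fixes d n :: nat and f :: "nat list \<Rightarrow> nat" and xs :: "nat list"
  assumes "d > 0"
    and "tupling_function d f"
    and "cubic_shells d f"
    and "xs \<in> tuples d"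
    and "\<forall>x \<in> set xs. num_bits x \<le> n"
  shows "num_bits (f xs) \<le> n * d"
proof -
  have "set xs \<subseteq> {..<2 ^ n}"
    using assms(5) by (auto simp: num_bits_le_iff)
  then have "f xs < (2 ^ n) ^ d"
    using cubic_shells_less_power assms by blast
  then show ?thesis
    by (simp add: num_bits_le_iff power_mult)
qed

end
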